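(* Let $X$ be a reflexive normed space with dual $X^*$ and let $I,K$ be two ideals on $\mathbb{N}$. If a sequence $\{f_k\}_{k\in\mathbb{N}}$ in $X^*$ is weak* $I^K$-convergent to $f\in X^*$, then it is weak $I^K$-convergent to $f$.
   Context: $\mathbb{N}$ is the set of positive integers. $X$ is reflexive if the canonical map $X\to X^{**}$ is surjective. An ideal on $\mathbb{N}$ is a class $I\subset 2^{\mathbb{N}}$ containing $\emptyset$ such that $A,B\in I$ implies $A\cup B\in I$, and $A\in I$, $B\subset A$ implies $B\in I$. Write $F(I)=\{A\subset\mathbb{N}:\mathbb{N}\setminus A\in I\}$. A sequence $\{g_k\}$ in $X^*$ is weak $K$-convergent to $f\in X^*$ if for every $\epsilon>0$ and every $h\in X^{**}$, $\{k\in\mathbb{N}:|h(g_k)-h(f)|\ge\epsilon\}\in K$. It is weak* $K$-convergent to $f\in X^*$ if for every $\epsilon>0$ and every $x\in X$, $\{k\in\mathbb{N}:|g_k(x)-f(x)|\ge\epsilon\}\in K$. A sequence $\{f_k\}$ in $X^*$ is weak $I^K$-convergent (respectively weak* $I^K$-convergent) to $f\in X^*$ if there exists $M\in F(I)$ such that the sequence $\{g_k\}$ in $X^*$ defined by $g_k=f_k$ if $k\in M$ and $g_k=f$ if $k\notin M$ is weak $K$-convergent (respectively weak* $K$-convergent) to $f$. *)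

theory Defs
  imports "HOL-Analysis.Analysis" "HOL-Library.FuncSet"
begin

text \<open>
  The scalar field is kept general so that real and complex normed spaces are both covered: up to
  isomorphism, the only instances of \<^class>\<open>real_normed_field\<close> are the reals and the
  complex numbers. A normed space over \<open>'k\<close> is a real normed space whose scalar
  multiplication is extended to \<open>'k\<close>. A real normed space is the case
  \<open>smul = (*\<^sub>R)\<close>.
\<close>

locale normed_space_over = vector_space smul
  for smul :: "'k::real_normed_field \<Rightarrow> 'a::real_normed_vector \<Rightarrow> 'a" +
  assumes smul_of_real: "smul (of_real r) x = r *\<^sub>R x"
    and norm_smul: "norm (smul c x) = norm c * norm x"

text \<open>
  The norm of the dual is the operator norm of the type of bounded (real-)linear maps.
\<close>

definition dual ::
  "('k::real_normed_field \<Rightarrow> 'a::real_normed_vector \<Rightarrow> 'a) \<Rightarrow> ('a \<Rightarrow>\<^sub>L 'k) set" where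
  "dual smul = {g. \<forall>c x. blinfun_apply g (smul c x) = c * blinfun_apply g x}"

text \<open>
  The dual is a set rather than a type, so an element of the bidual is a function on that set,
  made unique by being \<^const>\<open>undefined\<close> outside it. The composition in the third clause is
  the scalar multiple of \<open>g\<close> by \<open>c\<close>.
\<close>

definition bidual ::
  "('k::real_normed_field \<Rightarrow> 'a::real_normed_vector \<Rightarrow> 'a) \<Rightarrow> (('a \<Rightarrow>\<^sub>L 'k) \<Rightarrow> 'k) set" where
  "bidual smul = {h \<in> extensional (dual smul).
     (\<forall>g\<in>dual smul. \<forall>g'\<in>dual smul. h (g + g') = h g + h g') \<and>
     (\<forall>c. \<forall>g\<in>dual smul. h (blinfun_mult_right c o\<^sub>L g) = c * h g) \<and>
     (\<exists>C. \<forall>g\<in>dual smul. norm (h g) \<le> C * norm g)}"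

definition canonical_map ::
  "('k::real_normed_field \<Rightarrow> 'a::real_normed_vector \<Rightarrow> 'a) \<Rightarrow> 'a \<Rightarrow> ('a \<Rightarrow>\<^sub>L 'k) \<Rightarrow> 'k" where
  "canonical_map smul x = (\<lambda>g\<in>dual smul. blinfun_apply g x)"

definition reflexive_space ::
  "('k::real_normed_field \<Rightarrow> 'a::real_normed_vector \<Rightarrow> 'a) \<Rightarrow> bool" where
  "reflexive_space smul \<longleftrightarrow> canonical_map smul ` UNIV = bidual smul"

lemma dual_add: "g \<in> dual smul \<Longrightarrow> g' \<in> dual smul \<Longrightarrow> g + g' \<in> dual smul"
  by (simp add: dual_def blinfun.add_left distrib_left)

lemma dual_smul: "g \<in> dual smul \<Longrightarrow> blinfun_mult_right c o\<^sub>L g \<in> dual smul"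
  by (simp add: dual_def blinfun_mult_right.rep_eq)

lemma canonical_map_in_bidual: "canonical_map smul x \<in> bidual smul"
proof -
  have "\<forall>g\<in>dual smul. norm (canonical_map smul x g) \<le> norm x * norm g"
    using norm_blinfun by (auto simp: canonical_map_def mult.commute)
  then show ?thesis
    by (auto simp: bidual_def canonical_map_def dual_add dual_smul blinfun.add_left
        blinfun_mult_right.rep_eq)
qed

lemma normed_space_over_scaleR:
  "normed_space_over ((*\<^sub>R) :: real \<Rightarrow> 'a::real_normed_vector \<Rightarrow> 'a)"
  by unfold_locales (auto simp: algebra_simps)

lemma dual_scaleR: "dual ((*\<^sub>R) :: real \<Rightarrow> 'a::real_normed_vector \<Rightarrow> 'a) = UNIV"
  by (auto simp: dual_def blinfun.scaleR_right)

lemma bidual_scaleR: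
  "bidual ((*\<^sub>R) :: real \<Rightarrow> 'a::real_normed_vector \<Rightarrow> 'a) = range blinfun_apply"
proof -
  have mult: "blinfun_mult_right c o\<^sub>L g = c *\<^sub>R g" for c and g :: "'a \<Rightarrow>\<^sub>L real"
    by (rule blinfun_eqI) (simp add: blinfun_mult_right.rep_eq blinfun.scaleR_left)
  have "h \<in> bidual ((*\<^sub>R) :: real \<Rightarrow> 'a \<Rightarrow> 'a) \<longleftrightarrow> bounded_linear h" for h
    by (auto simp: bidual_def dual_scaleR mult bounded_linear_def bounded_linear_axioms_def
        linear_iff mult.commute)
  moreover have "range blinfun_apply = {h :: ('a \<Rightarrow>\<^sub>L real) \<Rightarrow> real. bounded_linear h}"
    using type_definition.Rep_range[OF type_definition_blinfun] .
  ultimately show ?thesis by auto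
qed

text \<open>The natural numbers of the source start at 1; the value at index 0 is never used.\<close>

abbreviation pos_nats :: "nat set" where
  "pos_nats \<equiv> {1..}"

definition ideal_on_pos_nats :: "nat set set \<Rightarrow> bool" where
  "ideal_on_pos_nats I \<longleftrightarrow> I \<subseteq> Pow pos_nats \<and> {} \<in> I \<and>
     (\<forall>A\<in>I. \<forall>B\<in>I. A \<union> B \<in> I) \<and> (\<forall>A\<in>I. \<forall>B. B \<subseteq> A \<longrightarrow> B \<in> I)"

definition dual_filter :: "nat set set \<Rightarrow> nat set set" where
  "dual_filter I = {A. A \<subseteq> pos_nats \<and> pos_nats - A \<in> I}"

definition weak_convergent ::
  "('k::real_normed_field \<Rightarrow> 'a::real_normed_vector \<Rightarrow> 'a) \<Rightarrow> nat set set \<Rightarrow>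
     (nat \<Rightarrow> 'a \<Rightarrow>\<^sub>L 'k) \<Rightarrow> ('a \<Rightarrow>\<^sub>L 'k) \<Rightarrow> bool" where
  "weak_convergent smul K g f \<longleftrightarrow>
     (\<forall>\<epsilon>>0. \<forall>h\<in>bidual smul. {k \<in> pos_nats. norm (h (g k) - h f) \<ge> \<epsilon>} \<in> K)"

definition weak_star_convergent ::
  "nat set set \<Rightarrow> (nat \<Rightarrow> 'a::real_normed_vector \<Rightarrow>\<^sub>L 'k::real_normed_field) \<Rightarrow>
     ('a \<Rightarrow>\<^sub>L 'k) \<Rightarrow> bool" where
  "weak_star_convergent K g f \<longleftrightarrow>
     (\<forall>\<epsilon>>0. \<forall>x. {k \<in> pos_nats. norm (blinfun_apply (g k) x - blinfun_apply f x) \<ge> \<epsilon>} \<in> K)"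

definition weak_IK_convergent ::
  "('k::real_normed_field \<Rightarrow> 'a::real_normed_vector \<Rightarrow> 'a) \<Rightarrow> nat set set \<Rightarrow> nat set set \<Rightarrow>
     (nat \<Rightarrow> 'a \<Rightarrow>\<^sub>L 'k) \<Rightarrow> ('a \<Rightarrow>\<^sub>L 'k) \<Rightarrow> bool" where
  "weak_IK_convergent smul I K fs f \<longleftrightarrow>
     (\<exists>M\<in>dual_filter I. weak_convergent smul K (\<lambda>k. if k \<in> M then fs k else f) f)"

definition weak_star_IK_convergent ::
  "nat set set \<Rightarrow> nat set set \<Rightarrow>
     (nat \<Rightarrow> 'a::real_normed_vector \<Rightarrow>\<^sub>L 'k::real_normed_field) \<Rightarrow> ('a \<Rightarrow>\<^sub>L 'k) \<Rightarrow> bool" where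
  "weak_star_IK_convergent I K fs f \<longleftrightarrow>
     (\<exists>M\<in>dual_filter I. weak_star_convergent K (\<lambda>k. if k \<in> M then fs k else f) f)"

end

theory Submission
  imports Defs
begin

lemma weak_convergent_if_weak_star_convergent:
  assumes "reflexive_space smul"
    and "\<forall>k\<in>pos_nats. g k \<in> dual smul" and "f \<in> dual smul"
    and "weak_star_convergent K g f"
  shows "weak_convergent smul K g f"
  unfolding weak_convergent_def
proof (intro allI impI ballI)
  fix \<epsilon> :: real and h
  assume "\<epsilon> > 0" and "h \<in> bidual smul"
  then obtain x where h: "h = canonical_map smul x"
    using assms(1) by (auto simp: reflexive_space_def)
  have "{k \<in> pos_nats. norm (h (g k) - h f) \<ge> \<epsilon>} =
      {k \<in> pos_nats. norm (blinfun_apply (g k) x - blinfun_apply f x) \<ge> \<epsilon>}"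
    using assms(2,3) by (auto simp: h canonical_map_def)
  with assms(4) \<open>\<epsilon> > 0\<close>
  show "{k \<in> pos_nats. norm (h (g k) - h f) \<ge> \<epsilon>} \<in> K"
    by (simp add: weak_star_convergent_def)
qed

theorem theorem4p4:
  fixes smul :: "'k::real_normed_field \<Rightarrow> 'a::real_normed_vector \<Rightarrow> 'a"
    and I K :: "nat set set"
    and fs :: "nat \<Rightarrow> 'a \<Rightarrow>\<^sub>L 'k"
    and f :: "'a \<Rightarrow>\<^sub>L 'k"
  assumes "normed_space_over smul"
    and "reflexive_space smul"
    and "ideal_on_pos_nats I"
    and "ideal_on_pos_nats K"
    and "\<forall>k\<in>pos_nats. fs k \<in> dual smul"
    and "f \<in> dual smul"
    and "weak_star_IK_convergent I K fs f"
  shows "weak_IK_convergent smul I K fs f"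
proof -
  obtain M where M: "M \<in> dual_filter I"
    and conv: "weak_star_convergent K (\<lambda>k. if k \<in> M then fs k else f) f"
    using assms(7) by (auto simp: weak_star_IK_convergent_def)
  have "\<forall>k\<in>pos_nats. (if k \<in> M then fs k else f) \<in> dual smul"
    using assms(5,6) by simp
  then have "weak_convergent smul K (\<lambda>k. if k \<in> M then fs k else f) f"
    using assms(2,6) conv by (intro weak_convergent_if_weak_star_convergent)
  with M show ?thesis
    by (auto simp: weak_IK_convergent_def)
qed

end
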